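(* There is an algorithm that, given a connected $2K_2$-free graph $G$ with $n$ vertices and maximum degree $\Delta$, finds in time $O(n^2\Delta)$ a clique separator of $G$ of minimum cardinality (or determines that $G$ has none) and a stable separator of $G$ of minimum cardinality (or determines that $G$ has none).
   Context: Graphs are finite, simple and undirected. A graph is $2K_2$-free if it has no two edges $\{a,b\},\{c,d\}$ on four distinct vertices with $\{a,c\},\{a,d\},\{b,c\},\{b,d\}\notin E(G)$. For a graph with at least two vertices that is not complete, a vertex separator is a set $R\subset V(G)$ such that $G\setminus R$ (the subgraph induced on $V(G)\setminus R$) has at least two connected components; it is a minimal vertex separator if no proper subset of $R$ is a vertex separator. By convention, for a complete graph on at least two vertices the minimal vertex separators are the neighbourhoods of its vertices, and for the one-vertex graph the whole vertex set is the minimal vertex separator. A stable separator is a minimal vertex separator whose vertices are pairwise non-adjacent; a clique separator is a minimal vertex separator whose vertices are pairwise adjacent. *)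

theory Defs
  imports "Graph_Theory.Graph_Theory"
begin

section \<open>Separators\<close>

text \<open>
  As in the Graph-Theory library, a finite simple undirected graph is a finite symmetric
  digraph without loops and parallel arcs (locales \<^locale>\<open>graph\<close> and \<^locale>\<open>pair_graph\<close>).
  In such a graph the strongly connected components are the connected components,
  and the out-degree of a vertex is its degree.
\<close>

definition two_K2_free :: "('a, 'b) pre_digraph \<Rightarrow> bool" where
  "two_K2_free G \<longleftrightarrow>
     \<not> (\<exists>a b c d. distinct [a, b, c, d] \<and> a \<rightarrow>\<^bsub>G\<^esub> b \<and> c \<rightarrow>\<^bsub>G\<^esub> d \<and>
          \<not> a \<rightarrow>\<^bsub>G\<^esub> c \<and> \<not> a \<rightarrow>\<^bsub>G\<^esub> d \<and> \<not> b \<rightarrow>\<^bsub>G\<^esub> c \<and> \<not> b \<rightarrow>\<^bsub>G\<^esub> d)"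

definition max_degree :: "('a, 'b) pre_digraph \<Rightarrow> nat" where
  "max_degree G = Max (out_degree G ` verts G)"

definition neighbourhood :: "('a, 'b) pre_digraph \<Rightarrow> 'a \<Rightarrow> 'a set" where
  "neighbourhood G v = {u. v \<rightarrow>\<^bsub>G\<^esub> u}"

definition vertex_separator :: "('a, 'b) pre_digraph \<Rightarrow> 'a set \<Rightarrow> bool" where
  "vertex_separator G R \<longleftrightarrow>
     R \<subseteq> verts G \<and> card (pre_digraph.sccs (G \<restriction> (verts G - R))) \<ge> 2"

definition minimal_vertex_separator :: "('a, 'b) pre_digraph \<Rightarrow> 'a set \<Rightarrow> bool" where
  "minimal_vertex_separator G R \<longleftrightarrow>
     (if card (verts G) = 1 then R = verts G
      else if complete_digraph (card (verts G)) G then \<exists>v \<in> verts G. R = neighbourhood G v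
      else vertex_separator G R \<and> (\<forall>R'. R' \<subset> R \<longrightarrow> \<not> vertex_separator G R'))"

definition stable_separator :: "('a, 'b) pre_digraph \<Rightarrow> 'a set \<Rightarrow> bool" where
  "stable_separator G R \<longleftrightarrow>
     minimal_vertex_separator G R \<and> (\<forall>u \<in> R. \<forall>v \<in> R. u \<noteq> v \<longrightarrow> \<not> u \<rightarrow>\<^bsub>G\<^esub> v)"

definition clique_separator :: "('a, 'b) pre_digraph \<Rightarrow> 'a set \<Rightarrow> bool" where
  "clique_separator G R \<longleftrightarrow>
     minimal_vertex_separator G R \<and> (\<forall>u \<in> R. \<forall>v \<in> R. u \<noteq> v \<longrightarrow> u \<rightarrow>\<^bsub>G\<^esub> v)"


section \<open>Word RAM\<close>

text \<open>
  Algorithms are programs of a random access machine with registers and an indirectly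
  addressed memory, both holding natural numbers. Every instruction and every evaluation of
  a branching condition takes one time unit. To keep this unit-cost measure honest, a run
  is parametrised by a bound \<open>W\<close> on the contents of all registers and memory cells: a run
  that exceeds it is stuck. Bounds polynomial in \<open>n\<close> amount to words of \<open>O(log n)\<close> bits.
\<close>

record state =
  reg :: "nat \<Rightarrow> nat"
  mem :: "nat \<Rightarrow> nat"

datatype operand = Imm nat | Reg nat

datatype instr =
    Move nat operand
  | Add nat operand operand
  | Sub nat operand operand
  | Mult nat operand operand
  | Load nat operand
  | Store operand operand

datatype test = Less operand operand | Equal operand operand

datatype prog =
    Skip
  | Instr instr
  | Seq prog prog
  | If test prog prog
  | While test prog

fun opval :: "operand \<Rightarrow> state \<Rightarrow> nat" where
  "opval (Imm k) s = k"
| "opval (Reg i) s = reg s i"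

definition set_reg :: "nat \<Rightarrow> nat \<Rightarrow> state \<Rightarrow> state" where
  "set_reg i x s = s\<lparr>reg := (reg s)(i := x)\<rparr>"

fun step :: "instr \<Rightarrow> state \<Rightarrow> state" where
  "step (Move i x) s = set_reg i (opval x s) s"
| "step (Add i x y) s = set_reg i (opval x s + opval y s) s"
| "step (Sub i x y) s = set_reg i (opval x s - opval y s) s"
| "step (Mult i x y) s = set_reg i (opval x s * opval y s) s"
| "step (Load i a) s = set_reg i (mem s (opval a s)) s"
| "step (Store a x) s = s\<lparr>mem := (mem s)(opval a s := opval x s)\<rparr>"

fun holds :: "test \<Rightarrow> state \<Rightarrow> bool" where
  "holds (Less x y) s \<longleftrightarrow> opval x s < opval y s"
| "holds (Equal x y) s \<longleftrightarrow> opval x s = opval y s"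

definition within_words :: "nat \<Rightarrow> state \<Rightarrow> bool" where
  "within_words W s \<longleftrightarrow> (\<forall>i. reg s i \<le> W \<and> mem s i \<le> W)"

text \<open>
  \<open>exec W p s t s'\<close>: started in state \<open>s\<close>, the program \<open>p\<close> halts in state \<open>s'\<close> after \<open>t\<close>
  time units, without ever exceeding the word bound \<open>W\<close>.
\<close>

inductive exec :: "nat \<Rightarrow> prog \<Rightarrow> state \<Rightarrow> nat \<Rightarrow> state \<Rightarrow> bool" for W :: nat where
  Skip: "exec W Skip s 1 s"
| Instr: "within_words W s \<Longrightarrow> within_words W (step i s) \<Longrightarrow> exec W (Instr i) s 1 (step i s)"
| Seq: "exec W p s t s' \<Longrightarrow> exec W q s' t' s'' \<Longrightarrow> exec W (Seq p q) s (t + t') s''"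
| IfTrue: "holds b s \<Longrightarrow> exec W p s t s' \<Longrightarrow> exec W (If b p q) s (1 + t) s'"
| IfFalse: "\<not> holds b s \<Longrightarrow> exec W q s t s' \<Longrightarrow> exec W (If b p q) s (1 + t) s'"
| WhileFalse: "\<not> holds b s \<Longrightarrow> exec W (While b p) s 1 s"
| WhileTrue: "holds b s \<Longrightarrow> exec W p s t s' \<Longrightarrow> exec W (While b p) s' t' s'' \<Longrightarrow>
    exec W (While b p) s (1 + t + t') s''"

inductive_cases SkipE: "exec W Skip s t s'"
inductive_cases InstrE: "exec W (Instr i) s t s'"
inductive_cases SeqE: "exec W (Seq p q) s t s'"
inductive_cases IfE: "exec W (If b p q) s t s'"
inductive_cases WhileE: "exec W (While b p) s t s'"

text \<open>Hence a program has at most one run, and it is immaterial that runs are relational.\<close>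

lemma exec_deterministic:
  "exec W p s t s' \<Longrightarrow> exec W p s u s'' \<Longrightarrow> u = t \<and> s'' = s'"
proof (induction arbitrary: u s'' rule: exec.induct)
  case (Skip s)
  then show ?case by (auto elim: SkipE)
next
  case (Instr s i)
  then show ?case by (auto elim: InstrE)
next
  case (Seq p s t s' q t' r)
  from Seq.prems obtain u1 s1 u2
    where 1: "exec W p s u1 s1" and 2: "exec W q s1 u2 s''" and 3: "u = u1 + u2"
    by (rule SeqE)
  from Seq.IH(1)[OF 1] have "u1 = t" "s1 = s'" by simp_all
  with Seq.IH(2)[of u2 s''] 2 3 show ?case by simp
next
  case (IfTrue b s p t s' q)
  from IfTrue.prems obtain v where "exec W p s v s''" "u = 1 + v"
    by (rule IfE) (use IfTrue.hyps(1) in simp_all)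
  with IfTrue.IH[of v s''] show ?case by simp
next
  case (IfFalse b s q t s' p)
  from IfFalse.prems obtain v where "exec W q s v s''" "u = 1 + v"
    by (rule IfE) (use IfFalse.hyps(1) in simp_all)
  with IfFalse.IH[of v s''] show ?case by simp
next
  case (WhileFalse b s p)
  from WhileFalse.prems show ?case by (rule WhileE) (use WhileFalse.hyps in simp_all)
next
  case (WhileTrue b s p t s' t' r)
  from WhileTrue.prems obtain u1 s1 u2
    where 1: "exec W p s u1 s1" and 2: "exec W (While b p) s1 u2 s''" and 3: "u = 1 + u1 + u2"
    by (rule WhileE) (use WhileTrue.hyps(1) in simp_all)
  from WhileTrue.IH(1)[OF 1] have "u1 = t" "s1 = s'" by simp_all
  with WhileTrue.IH(2)[of u2 s''] 2 3 show ?case by simp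
qed


section \<open>Input and output\<close>

text \<open>
  A graph on the vertices \<open>0, \<dots>, n - 1\<close> is given by \<open>n\<close> in register 0 and its adjacency
  matrix, row by row, in the memory cells \<open>0, \<dots>, n * n - 1\<close>; all else is 0.
\<close>

definition input_state :: "nat \<Rightarrow> nat pair_pre_digraph \<Rightarrow> state" where
  "input_state n G =
     \<lparr>reg = (\<lambda>i. if i = 0 then n else 0),
      mem = (\<lambda>a. if a < n * n \<and> (a div n, a mod n) \<in> parcs G then 1 else 0)\<rparr>"

text \<open>
  An optional vertex set is returned as a flag in register \<open>i\<close> (0 for ``there is none'') and
  a characteristic vector in the memory cells \<open>a, \<dots>, a + n - 1\<close>.
\<close>

definition output_set :: "nat \<Rightarrow> nat \<Rightarrow> nat \<Rightarrow> state \<Rightarrow> nat set option" where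
  "output_set n i a s =
     (if reg s i = 0 then None else Some {v. v < n \<and> mem s (a + v) \<noteq> 0})"

definition min_card_answer :: "('a set \<Rightarrow> bool) \<Rightarrow> 'a set option \<Rightarrow> bool" where
  "min_card_answer P X \<longleftrightarrow>
     (case X of None \<Rightarrow> \<nexists>S. P S | Some S \<Rightarrow> is_arg_min card P S)"

end

theory Submission
  imports Defs
begin

text \<open>
  Removing a separator \<open>R\<close> from a \<open>2K\<^sub>2\<close>-free graph leaves at most one component that has an
  edge, so some vertex \<open>v\<close> becomes isolated; then \<open>R\<close> contains the neighbourhood \<open>N(v)\<close>, which
  is itself a separator (\<open>separator_contains_neighbourhood\<close>). Hence every minimal vertex
  separator is one of the \<open>n\<close> sets \<open>N(v)\<close>. The converse fails, but it need not be decided which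
  of these sets are minimal separators: being a clique and being stable are inherited by
  subsets, and so a clique (stable) neighbourhood that is not a minimal separator contains, or is
  at least larger than, a clique (stable) one that is
  (\<open>homogeneous_neighbourhood_minimal_or_smaller\<close>). A minimum clique (stable) separator is
  therefore the same thing as a clique (stable) neighbourhood of minimum size
  (\<open>min_card_answer_neighbourhood\<close>). Only the one-vertex graph, whose separator is not a
  neighbourhood, is treated apart.

  The program goes through all vertices \<open>v\<close>. For every neighbour \<open>u\<close> of \<open>v\<close> it compares row \<open>u\<close>
  of the adjacency matrix with row \<open>v\<close>, in time \<open>O(n)\<close>, to see whether \<open>u\<close> is adjacent to all
  (to none) of the other neighbours of \<open>v\<close>. This costs \<open>O(n + n deg(v))\<close> for each \<open>v\<close> and
  \<open>O(n\<^sup>2 \<Delta>)\<close> in total. Cliques and stable sets differ only in the matrix entry that is expected,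
  so one search, parametrised by that bit, serves both (\<open>runs_search\<close>).

  Runs are verified with a total-correctness judgement that carries a time bound; loop-free code
  is reduced to its weakest precondition (\<open>runs_straight_line\<close>), and all loops are counting
  loops covered by one invariant rule (\<open>runs_for_loop\<close>).
\<close>

section \<open>Minimal separators and neighbourhoods\<close>

lemma arcs_ends_induce:
  "(x, y) \<in> arcs_ends (G \<restriction> S) \<longleftrightarrow> x \<in> S \<and> y \<in> S \<and> (x, y) \<in> arcs_ends G"
  by (auto simp: arcs_ends_def arc_to_ends_def)

text \<open>
  Unreachability from \<open>u\<close> to \<open>w\<close> in one direction is enough: components are counted as strong
  components, and two vertices share one iff they reach each other.
\<close>
lemma (in fin_digraph) vertex_separator_iff_unreachable:
  "vertex_separator G R \<longleftrightarrow> R \<subseteq> verts G \<and>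
     (\<exists>u \<in> verts G - R. \<exists>w \<in> verts G - R. \<not> u \<rightarrow>\<^sup>*\<^bsub>G \<restriction> (verts G - R)\<^esub> w)"
proof -
  let ?S = "verts G - R"
  interpret H: fin_digraph "G \<restriction> ?S"
    by (intro fin_digraph.intro wellformed_induce_subgraph)
       (simp add: fin_digraph_axioms_def)
  have same: "H.scc_of u = H.scc_of w \<longleftrightarrow>
      u \<rightarrow>\<^sup>*\<^bsub>G \<restriction> ?S\<^esub> w \<and> w \<rightarrow>\<^sup>*\<^bsub>G \<restriction> ?S\<^esub> u" if "u \<in> ?S" "w \<in> ?S" for u w
    using that unfolding H.scc_of_def
    by (auto intro: H.reachable_trans H.reachable_refl)
  have "card H.sccs = card (H.scc_of ` ?S)"
    by (simp add: H.card_sccs_verts[symmetric] H.sccs_verts_conv_scc_of)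
  moreover have "2 \<le> card A \<longleftrightarrow> (\<exists>x \<in> A. \<exists>y \<in> A. x \<noteq> y)" if "finite A" for A :: "'a set set"
  proof -
    have "card A \<le> 1 \<longleftrightarrow> (\<forall>x \<in> A. \<forall>y \<in> A. x = y)"
      using card_le_Suc0_iff_eq[OF that] by simp
    moreover have "2 \<le> card A \<longleftrightarrow> \<not> card A \<le> 1" by arith
    ultimately show ?thesis by blast
  qed
  ultimately have "2 \<le> card H.sccs \<longleftrightarrow>
      (\<exists>u \<in> ?S. \<exists>w \<in> ?S. H.scc_of u \<noteq> H.scc_of w)"
    by simp
  also have "\<dots> \<longleftrightarrow> (\<exists>u \<in> ?S. \<exists>w \<in> ?S. \<not> u \<rightarrow>\<^sup>*\<^bsub>G \<restriction> ?S\<^esub> w)"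
    using same by blast
  finally show ?thesis unfolding vertex_separator_def by blast
qed

lemma (in wf_digraph) no_out_arcs_unreachable:
  assumes "\<And>x. \<not> u \<rightarrow>\<^bsub>G\<^esub> x" "u \<noteq> w"
  shows "\<not> u \<rightarrow>\<^sup>* w"
  using assms by (metis converse_reachable_cases)

lemma (in fin_digraph) neighbourhood_separator:
  assumes "v \<in> verts G" "u \<in> verts G" "u \<noteq> v" "u \<notin> neighbourhood G v" "v \<notin> neighbourhood G v"
  shows "vertex_separator G (neighbourhood G v)"
proof -
  let ?S = "verts G - neighbourhood G v"
  interpret H: wf_digraph "G \<restriction> ?S" by (rule wellformed_induce_subgraph)
  have "\<not> v \<rightarrow>\<^sup>*\<^bsub>G \<restriction> ?S\<^esub> u"
    using assms(3)
    by (intro H.no_out_arcs_unreachable) (auto simp: arcs_ends_induce neighbourhood_def)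
  moreover have "neighbourhood G v \<subseteq> verts G"
    by (auto simp: neighbourhood_def)
  ultimately show ?thesis
    using assms by (auto simp: vertex_separator_iff_unreachable)
qed

text \<open>
  Let \<open>u\<close> and \<open>w\<close> lie in different components of \<open>G - R\<close>. Edges \<open>u u'\<close> and \<open>w w'\<close> of \<open>G - R\<close>
  would form a \<open>2K\<^sub>2\<close>, so \<open>u\<close> or \<open>w\<close> is isolated in \<open>G - R\<close>, and the other one witnesses
  that its neighbourhood separates.
\<close>
lemma (in graph) separator_contains_neighbourhood:
  assumes free: "two_K2_free G" and sep: "vertex_separator G R"
  obtains v where "v \<in> verts G" "neighbourhood G v \<subseteq> R" "vertex_separator G (neighbourhood G v)"
proof -
  let ?S = "verts G - R"
  interpret H: wf_digraph "G \<restriction> ?S" by (rule wellformed_induce_subgraph)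
  from sep obtain u w where u: "u \<in> ?S" and w: "w \<in> ?S"
    and unreach: "\<not> u \<rightarrow>\<^sup>*\<^bsub>G \<restriction> ?S\<^esub> w"
    unfolding vertex_separator_iff_unreachable by blast
  have neq: "u \<noteq> w" using unreach u H.reachable_refl by auto
  have sub: "neighbourhood G v \<subseteq> R" if "\<not> (\<exists>x \<in> ?S. v \<rightarrow>\<^bsub>G\<^esub> x)" for v
    using that by (auto simp: neighbourhood_def dest: adj_in_verts)
  have loopfree: "v \<notin> neighbourhood G v" for v
    by (auto simp: neighbourhood_def dest: adj_not_same)
  consider "\<not> (\<exists>x \<in> ?S. u \<rightarrow>\<^bsub>G\<^esub> x)" | "\<not> (\<exists>x \<in> ?S. w \<rightarrow>\<^bsub>G\<^esub> x)"
  proof -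
    have False if u': "u' \<in> ?S" "u \<rightarrow>\<^bsub>G\<^esub> u'" and w': "w' \<in> ?S" "w \<rightarrow>\<^bsub>G\<^esub> w'" for u' w'
    proof -
      have ww: "w' \<rightarrow>\<^bsub>G\<^esub> w" using w' by (blast intro: graph_symmetric)
      have H_adj: "x \<rightarrow>\<^sup>*\<^bsub>G \<restriction> ?S\<^esub> y" if "x \<in> ?S" "y \<in> ?S" "x \<rightarrow>\<^bsub>G\<^esub> y" for x y
        using that by (intro H.reachable_adjI) (simp add: arcs_ends_induce)
      have refl: "x \<rightarrow>\<^sup>*\<^bsub>G \<restriction> ?S\<^esub> x" if "x \<in> ?S" for x
        using that by (intro H.reachable_refl) simp
      have far: "x \<noteq> y \<and> \<not> x \<rightarrow>\<^bsub>G\<^esub> y" if "x \<in> {u, u'}" "y \<in> {w, w'}" for x y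
      proof -
        have S: "x \<in> ?S" "y \<in> ?S" using that u u' w w' by auto
        have "u \<rightarrow>\<^sup>*\<^bsub>G \<restriction> ?S\<^esub> x" using that(1) H_adj[OF u u'] refl[OF u] by auto
        moreover have "y \<rightarrow>\<^sup>*\<^bsub>G \<restriction> ?S\<^esub> w" using that(2) H_adj[OF w'(1) w ww] refl[OF w] by auto
        ultimately have "\<not> x \<rightarrow>\<^sup>*\<^bsub>G \<restriction> ?S\<^esub> y"
          using unreach H.reachable_trans by metis
        then show ?thesis using H_adj[OF S] refl[OF S(1)] by auto
      qed
      have "u \<noteq> u'" "w \<noteq> w'" using adj_not_same u'(2) w'(2) by metis+
      moreover have "u \<noteq> w" "u \<noteq> w'" "u' \<noteq> w" "u' \<noteq> w'"
        "\<not> u \<rightarrow>\<^bsub>G\<^esub> w" "\<not> u \<rightarrow>\<^bsub>G\<^esub> w'" "\<not> u' \<rightarrow>\<^bsub>G\<^esub> w" "\<not> u' \<rightarrow>\<^bsub>G\<^esub> w'"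
        using far[of u w] far[of u w'] far[of u' w] far[of u' w'] by simp_all
      ultimately have "distinct [u, u', w, w'] \<and> u \<rightarrow>\<^bsub>G\<^esub> u' \<and> w \<rightarrow>\<^bsub>G\<^esub> w' \<and>
          \<not> u \<rightarrow>\<^bsub>G\<^esub> w \<and> \<not> u \<rightarrow>\<^bsub>G\<^esub> w' \<and> \<not> u' \<rightarrow>\<^bsub>G\<^esub> w \<and> \<not> u' \<rightarrow>\<^bsub>G\<^esub> w'"
        using u'(2) w'(2) by simp
      then show False
        using free unfolding two_K2_free_def by blast
    qed
    then show thesis using that by blast
  qed
  then show thesis
  proof cases
    case 1
    moreover have "w \<notin> neighbourhood G u" using sub[OF 1] w by auto
    ultimately show thesis
      using that[of u] sub[of u] neighbourhood_separator[of u w] u w neq loopfree[of u] by auto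
  next
    case 2
    moreover have "u \<notin> neighbourhood G w" using sub[OF 2] u by auto
    ultimately show thesis
      using that[of w] sub[of w] neighbourhood_separator[of w u] u w neq loopfree[of w] by auto
  qed
qed

text \<open>The sets that are cliques (\<open>\<beta> = True\<close>) or stable (\<open>\<beta> = False\<close>).\<close>
definition homogeneous :: "('a, 'b) pre_digraph \<Rightarrow> bool \<Rightarrow> 'a set \<Rightarrow> bool" where
  "homogeneous G \<beta> R \<longleftrightarrow> (\<forall>u \<in> R. \<forall>w \<in> R. u \<noteq> w \<longrightarrow> (u \<rightarrow>\<^bsub>G\<^esub> w \<longleftrightarrow> \<beta>))"

lemma (in graph) minimal_vertex_separator_neighbourhood:
  assumes "two_K2_free G" "card (verts G) \<noteq> 1" "minimal_vertex_separator G R"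
  obtains v where "v \<in> verts G" "R = neighbourhood G v"
proof (cases "complete_digraph (card (verts G)) G")
  case True
  then show thesis using assms that unfolding minimal_vertex_separator_def by auto
next
  case False
  then have sep: "vertex_separator G R" and min: "\<And>R'. R' \<subset> R \<Longrightarrow> \<not> vertex_separator G R'"
    using assms(2,3) unfolding minimal_vertex_separator_def by auto
  show thesis
    by (rule separator_contains_neighbourhood[OF assms(1) sep]) (use that min in blast)
qed

text \<open>
  If \<open>v\<close> is not adjacent to all other vertices, \<open>N(v)\<close> separates and contains a minimal
  separator, which inherits homogeneity. If it is, and \<open>G\<close> is not complete, then \<open>N(v)\<close> can only
  be stable, so that \<open>G\<close> is a star with at least two leaves, and the neighbourhood \<open>{v}\<close> of a leaf
  is smaller.
\<close>
lemma (in graph) homogeneous_neighbourhood_minimal_or_smaller: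
  assumes n: "card (verts G) \<noteq> 1" and v: "v \<in> verts G" and hom: "homogeneous G \<beta> (neighbourhood G v)"
  obtains R where "minimal_vertex_separator G R" "homogeneous G \<beta> R"
    "R = neighbourhood G v \<or> card R < card (neighbourhood G v)"
proof (cases "complete_digraph (card (verts G)) G")
  case True
  then show thesis
    using that[of "neighbourhood G v"] n v hom unfolding minimal_vertex_separator_def by auto
next
  case False
  have fin: "finite (neighbourhood G x)" for x
    by (rule finite_subset[OF _ finite_verts]) (auto simp: neighbourhood_def)
  have loopfree: "x \<notin> neighbourhood G x" for x
    by (auto simp: neighbourhood_def dest: adj_not_same)
  have inside: "\<exists>R \<subseteq> neighbourhood G x. minimal_vertex_separator G R"
    if x: "x \<in> verts G" "y \<in> verts G" "y \<noteq> x" "y \<notin> neighbourhood G x" for x y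
  proof -
    let ?A = "{R. R \<subseteq> neighbourhood G x \<and> vertex_separator G R}"
    have "finite ?A" by (rule finite_subset[of _ "Pow (neighbourhood G x)"]) (auto simp: fin)
    moreover have "neighbourhood G x \<in> ?A" using neighbourhood_separator x loopfree by auto
    ultimately have "\<exists>R \<in> ?A. \<forall>R' \<in> ?A. R' \<subseteq> R \<longrightarrow> R = R'"
      by (intro finite_has_minimal) (simp, metis empty_iff)
    then obtain R where R: "R \<in> ?A" and min: "\<forall>R' \<in> ?A. R' \<subseteq> R \<longrightarrow> R = R'" ..
    have "\<not> vertex_separator G R'" if "R' \<subset> R" for R'
      using min that R by (metis (mono_tags, lifting) mem_Collect_eq psubset_eq subset_trans)
    then have "minimal_vertex_separator G R"
      using False n R unfolding minimal_vertex_separator_def by simp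
    then show ?thesis using \<open>R \<in> ?A\<close> by auto
  qed
  show thesis
  proof (cases "\<exists>y \<in> verts G. y \<noteq> v \<and> y \<notin> neighbourhood G v")
    case True
    then obtain R where R: "R \<subseteq> neighbourhood G v" "minimal_vertex_separator G R"
      using inside v by blast
    moreover have "homogeneous G \<beta> R" using hom R(1) unfolding homogeneous_def by blast
    moreover have "R = neighbourhood G v \<or> card R < card (neighbourhood G v)"
      using R(1) fin[of v] by (meson psubsetI psubset_card_mono)
    ultimately show thesis using that by blast
  next
    case universal: False
    have "arcs_ends G \<noteq> {(x, y). (x, y) \<in> verts G \<times> verts G \<and> x \<noteq> y}"
      using False graph_axioms unfolding complete_digraph_def by simp
    moreover have "arcs_ends G \<subseteq> {(x, y). (x, y) \<in> verts G \<times> verts G \<and> x \<noteq> y}"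
      by (auto dest: adj_in_verts adj_not_same)
    ultimately obtain x y where xy: "x \<in> verts G" "y \<in> verts G" "x \<noteq> y" "\<not> x \<rightarrow>\<^bsub>G\<^esub> y"
      by blast
    have nb: "neighbourhood G v = verts G - {v}"
      using universal loopfree by (auto simp: neighbourhood_def)
    have vx: "v \<noteq> x" "v \<noteq> y"
    proof -
      have adj: "v \<rightarrow>\<^bsub>G\<^esub> z" if "z \<in> verts G" "z \<noteq> v" for z
        using that nb unfolding neighbourhood_def by blast
      show "v \<noteq> x" using adj[OF xy(2)] xy(3,4) by metis
      show "v \<noteq> y" using adj[OF xy(1)] xy(3,4) graph_symmetric by metis
    qed
    have \<beta>: "\<beta> = False"
      using hom xy vx unfolding homogeneous_def nb by auto
    have "neighbourhood G x \<subseteq> {v}"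
    proof
      fix z assume "z \<in> neighbourhood G x"
      then have xz: "x \<rightarrow>\<^bsub>G\<^esub> z" by (simp add: neighbourhood_def)
      then have "z \<in> verts G" "x \<noteq> z" using adj_not_same adj_in_verts by metis+
      then show "z \<in> {v}"
        using hom xy(1) vx \<beta> xz unfolding homogeneous_def nb by (metis Diff_iff singleton_iff)
    qed
    moreover obtain R where R: "R \<subseteq> neighbourhood G x" "minimal_vertex_separator G R"
      using inside[OF xy(1,2) xy(3)[symmetric]] xy(4) by (auto simp: neighbourhood_def)
    ultimately have Rv: "R \<subseteq> {v}" by blast
    have "card R \<le> 1" using card_mono[OF _ Rv] by simp
    moreover have "card {x, y} \<le> card (neighbourhood G v)"
      using xy vx by (intro card_mono fin) (auto simp: nb)
    ultimately have "card R < card (neighbourhood G v)" using xy by simp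
    moreover have "homogeneous G \<beta> R" using Rv by (auto simp: homogeneous_def)
    ultimately show thesis using that R by blast
  qed
qed

text \<open>
  Minimising over a larger family gives the same answers if each of its additional members is
  beaten strictly by a member of the smaller one.
\<close>
lemma min_card_answer_transfer:
  assumes PQ: "\<And>R. P R \<Longrightarrow> Q R"
    and QP: "\<And>R. Q R \<Longrightarrow> \<exists>R'. P R' \<and> (R' = R \<or> card R' < card R)"
    and ans: "min_card_answer Q X"
  shows "min_card_answer P X"
proof (cases X)
  case None
  then show ?thesis using ans PQ by (auto simp: min_card_answer_def)
next
  case (Some S)
  then have S: "Q S" "\<And>R. Q R \<Longrightarrow> \<not> card R < card S"
    using ans by (auto simp: min_card_answer_def is_arg_min_def)
  have "P S" using QP[OF S(1)] S(2) PQ by blast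
  then show ?thesis
    using Some S(2) PQ by (auto simp: min_card_answer_def is_arg_min_def)
qed

lemma (in graph) min_card_answer_neighbourhood:
  assumes "two_K2_free G" "card (verts G) \<noteq> 1"
    and ans: "min_card_answer (\<lambda>R. (\<exists>v \<in> verts G. R = neighbourhood G v) \<and> homogeneous G \<beta> R) X"
  shows "min_card_answer (\<lambda>R. minimal_vertex_separator G R \<and> homogeneous G \<beta> R) X"
proof (rule min_card_answer_transfer[OF _ _ ans])
  fix R
  show "(\<exists>v \<in> verts G. R = neighbourhood G v) \<and> homogeneous G \<beta> R"
    if R: "minimal_vertex_separator G R \<and> homogeneous G \<beta> R"
  proof -
    obtain v where "v \<in> verts G" "R = neighbourhood G v"
      using minimal_vertex_separator_neighbourhood[OF assms(1,2)] R by blast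
    then show ?thesis using R by blast
  qed
  show "\<exists>R'. (minimal_vertex_separator G R' \<and> homogeneous G \<beta> R') \<and> (R' = R \<or> card R' < card R)"
    if "(\<exists>v \<in> verts G. R = neighbourhood G v) \<and> homogeneous G \<beta> R"
  proof -
    from that obtain v where v: "v \<in> verts G" "R = neighbourhood G v" "homogeneous G \<beta> R"
      by blast
    obtain R' where "minimal_vertex_separator G R'" "homogeneous G \<beta> R'" "R' = R \<or> card R' < card R"
      using homogeneous_neighbourhood_minimal_or_smaller[OF assms(2) v(1)] v(2,3) by metis
    then show ?thesis by blast
  qed
qed

section \<open>Timed total correctness\<close>

definition runs :: "nat \<Rightarrow> prog \<Rightarrow> state \<Rightarrow> nat \<Rightarrow> (state \<Rightarrow> bool) \<Rightarrow> bool" where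
  "runs W p s T Q \<longleftrightarrow> (\<exists>t s'. exec W p s t s' \<and> t \<le> T \<and> within_words W s' \<and> Q s')"

lemma runsI:
  "exec W p s t s' \<Longrightarrow> t \<le> T \<Longrightarrow> within_words W s' \<Longrightarrow> Q s' \<Longrightarrow> runs W p s T Q"
  unfolding runs_def by blast

lemma runs_mono:
  assumes "runs W p s T Q" "T \<le> T'" "\<And>s'. within_words W s' \<Longrightarrow> Q s' \<Longrightarrow> Q' s'"
  shows "runs W p s T' Q'"
  using assms unfolding runs_def by (meson le_trans)

lemma runs_Seq:
  assumes "runs W p s T R" "\<And>s'. within_words W s' \<Longrightarrow> R s' \<Longrightarrow> runs W q s' T' Q"
  shows "runs W (Seq p q) s (T + T') Q"
  using assms unfolding runs_def by (meson add_mono exec.Seq)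

lemma runs_If:
  assumes "holds b s \<Longrightarrow> runs W p s T Q" "\<not> holds b s \<Longrightarrow> runs W q s T Q"
  shows "runs W (If b p q) s (1 + T) Q"
proof (cases "holds b s")
  case True
  with assms(1) obtain t s' where "exec W p s t s'" "t \<le> T" "within_words W s'" "Q s'"
    unfolding runs_def by blast
  with True show ?thesis by (intro runsI[OF exec.IfTrue]) auto
next
  case False
  with assms(2) obtain t s' where "exec W q s t s'" "t \<le> T" "within_words W s'" "Q s'"
    unfolding runs_def by blast
  with False show ?thesis by (intro runsI[OF exec.IfFalse]) auto
qed

text \<open>
  Loops get the precondition \<open>False\<close>, so that \<open>wp\<close> and \<open>cost\<close> are sound for all programs without
  a side condition that excludes loops.
\<close>
fun wp :: "nat \<Rightarrow> prog \<Rightarrow> (state \<Rightarrow> bool) \<Rightarrow> state \<Rightarrow> bool" where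
  "wp W Skip Q s \<longleftrightarrow> Q s"
| "wp W (Instr i) Q s \<longleftrightarrow> within_words W (step i s) \<and> Q (step i s)"
| "wp W (Seq p q) Q s \<longleftrightarrow> wp W p (wp W q Q) s"
| "wp W (If b p q) Q s \<longleftrightarrow> (if holds b s then wp W p Q s else wp W q Q s)"
| "wp W (While b p) Q s \<longleftrightarrow> False"

fun cost :: "prog \<Rightarrow> nat" where
  "cost Skip = 1"
| "cost (Instr i) = 1"
| "cost (Seq p q) = cost p + cost q"
| "cost (If b p q) = 1 + max (cost p) (cost q)"
| "cost (While b p) = 0"

lemma runs_wp: "within_words W s \<Longrightarrow> wp W p Q s \<Longrightarrow> runs W p s (cost p) Q"
proof (induction p arbitrary: s Q)
  case Skip
  then show ?case by (auto intro: runsI exec.Skip)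
next
  case (Instr i)
  then show ?case by (auto intro: runsI exec.Instr)
next
  case (Seq p q)
  show ?case unfolding cost.simps
    by (rule runs_Seq[OF Seq.IH(1)[OF Seq.prems(1)]], use Seq.prems in simp) (rule Seq.IH(2))
next
  case (If b p q)
  show ?case unfolding cost.simps
  proof (rule runs_If)
    show "runs W p s (max (cost p) (cost q)) Q" if "holds b s"
      by (rule runs_mono[OF If.IH(1)[of s Q]]) (use If.prems that in auto)
    show "runs W q s (max (cost p) (cost q)) Q" if "\<not> holds b s"
      by (rule runs_mono[OF If.IH(2)[of s Q]]) (use If.prems that in auto)
  qed
next
  case (While b p)
  then show ?case by simp
qed

lemma runs_straight_line:
  assumes "within_words W s" "wp W p Q s" "cost p \<le> T"
  shows "runs W p s T Q"
  using runs_mono[OF runs_wp] assms by blast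

text \<open>Register 0 holds the number \<open>n\<close> of vertices throughout, hence it can serve as the loop bound.\<close>
definition for_loop :: "nat \<Rightarrow> prog \<Rightarrow> prog" where
  "for_loop i p = Seq (Instr (Move i (Imm 0)))
     (While (Less (Reg i) (Reg 0)) (Seq p (Instr (Add i (Reg i) (Imm 1)))))"

lemma reg_set_reg [simp]: "reg (set_reg i x s) j = (if j = i then x else reg s j)"
  by (simp add: set_reg_def)

lemma mem_set_reg [simp]: "mem (set_reg i x s) = mem s"
  by (simp add: set_reg_def)

lemma within_words_set_reg [simp]:
  "within_words W s \<Longrightarrow> within_words W (set_reg i x s) \<longleftrightarrow> x \<le> W"
  by (auto simp: within_words_def)

lemma within_words_store [simp]:
  "within_words W s \<Longrightarrow> mem s = m \<Longrightarrow> within_words W (s\<lparr>mem := m(a := x)\<rparr>) \<longleftrightarrow> x \<le> W"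
  by (auto simp: within_words_def)

text \<open>
  Besides the body, every iteration pays for the test and for the increment of the counter;
  initialising the counter and the final test cost 2.
\<close>
lemma runs_for_loop:
  assumes n: "reg s 0 = n" "n \<le> W" and s: "within_words W s" and i: "i \<noteq> 0"
    and init: "I 0 (set_reg i 0 s)"
    and body: "\<And>k s'. k < n \<Longrightarrow> within_words W s' \<Longrightarrow> reg s' 0 = n \<Longrightarrow> reg s' i = k \<Longrightarrow> I k s' \<Longrightarrow>
      runs W p s' (c k) (\<lambda>s''. reg s'' 0 = n \<and> reg s'' i = k \<and> I (Suc k) (set_reg i (Suc k) s''))"
  shows "runs W (for_loop i p) s (2 + (\<Sum>k<n. c k + 2)) (I n)"
proof -
  let ?loop = "While (Less (Reg i) (Reg 0)) (Seq p (Instr (Add i (Reg i) (Imm 1))))"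
  have "runs W ?loop s' (1 + (\<Sum>k=k..<n. c k + 2)) (I n)"
    if "k \<le> n" "within_words W s'" "reg s' 0 = n" "reg s' i = k" "I k s'" for k s'
    using that
  proof (induction k arbitrary: s' rule: inc_induct)
    case base
    then show ?case by (intro runsI[OF exec.WhileFalse]) auto
  next
    case (step k)
    from body[OF step(2,4,5,6,7)] obtain t s1 where 1: "exec W p s' t s1" "t \<le> c k"
      and s1: "within_words W s1" "reg s1 0 = n" "reg s1 i = k" "I (Suc k) (set_reg i (Suc k) s1)"
      unfolding runs_def by blast
    let ?s2 = "step (Add i (Reg i) (Imm 1)) s1"
    have 2: "exec W (Instr (Add i (Reg i) (Imm 1))) s1 1 (step (Add i (Reg i) (Imm 1)) s1)"
      using s1 step(2) n by (intro exec.Instr) auto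
    have "runs W ?loop (set_reg i (Suc k) s1) (1 + (\<Sum>k=Suc k..<n. c k + 2)) (I n)"
      using s1 step(2) n i by (intro step(3)) auto
    then obtain t' s3 where 3: "exec W ?loop (set_reg i (Suc k) s1) t' s3"
      "t' \<le> 1 + (\<Sum>k=Suc k..<n. c k + 2)" "within_words W s3" "I n s3"
      unfolding runs_def by blast
    have "exec W ?loop s' (1 + (t + 1) + t') s3"
    proof (rule exec.WhileTrue)
      show "holds (Less (Reg i) (Reg 0)) s'" using step by simp
      show "exec W (Seq p (Instr (Add i (Reg i) (Imm 1)))) s' (t + 1) (set_reg i (Suc k) s1)"
        using exec.Seq[OF 1(1) 2] s1 by simp
    qed (rule 3(1))
    moreover have "(\<Sum>k=k..<n. c k + 2) = c k + 2 + (\<Sum>k=Suc k..<n. c k + 2)"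
      using step(2) by (simp add: sum.atLeast_Suc_lessThan)
    ultimately show ?case using 1(2) 3 by (intro runsI) auto
  qed
  note loop = this[of 0]
  have "runs W (for_loop i p) s (1 + (1 + (\<Sum>k=0..<n. c k + 2))) (I n)"
    unfolding for_loop_def
  proof (rule runs_Seq)
    show "runs W (Instr (Move i (Imm 0))) s 1 (\<lambda>s'. s' = set_reg i 0 s)"
      using s by (intro runsI[OF exec.Instr]) auto
    show "runs W ?loop s' (1 + (\<Sum>k=0..<n. c k + 2)) (I n)"
      if "within_words W s'" "s' = set_reg i 0 s" for s'
      using that n init i by (intro loop) auto
  qed
  then show ?thesis by (simp add: atLeast0LessThan)
qed

section \<open>The program\<close>

text \<open>
  Register 0 holds \<open>n\<close>; registers 3, 4, 5 hold the loop counters \<open>v\<close>, \<open>u\<close>, \<open>w\<close>; registers 6 and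
  7 hold the addresses \<open>v * n\<close> and \<open>u * n\<close> of the rows of \<open>v\<close> and \<open>u\<close>; register 8 is an address
  and registers 9 and 10 are matrix entries. Register 11 counts the neighbours of \<open>v\<close>, and
  register 12 is nonzero as long as no pair of neighbours of \<open>v\<close> has refuted homogeneity. The
  smallest size found is kept in register 13, the vertex \<open>b\<close> attaining it as \<open>b + 1\<close> in the result
  register \<open>r\<close>, where 0 means that there is none yet. Register 14 is the address of the
  characteristic vector that is to be written.
\<close>

abbreviation seq_infix :: "prog \<Rightarrow> prog \<Rightarrow> prog" (infixr ";;" 60) where
  "p ;; q \<equiv> Seq p q"

definition read_entry :: "nat \<Rightarrow> nat \<Rightarrow> nat \<Rightarrow> prog" where
  "read_entry d b j = Instr (Add 8 (Reg b) (Reg j)) ;; Instr (Load d (Reg 8))"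

definition scan_pair :: "bool \<Rightarrow> prog" where
  "scan_pair \<beta> =
     read_entry 9 6 5 ;; read_entry 10 7 5 ;;
     If (Equal (Reg 9) (Imm 0)) Skip
       (If (Equal (Reg 4) (Reg 5)) Skip
         (If (Equal (Reg 10) (Imm (of_bool \<beta>))) Skip (Instr (Move 12 (Imm 0)))))"

definition scan_neighbour :: "bool \<Rightarrow> prog" where
  "scan_neighbour \<beta> =
     read_entry 9 6 4 ;;
     If (Equal (Reg 9) (Imm 0)) Skip
       ((Instr (Add 11 (Reg 11) (Imm 1)) ;; Instr (Mult 7 (Reg 4) (Reg 0))) ;;
        for_loop 5 (scan_pair \<beta>))"

definition scan_vertex :: "bool \<Rightarrow> nat \<Rightarrow> prog" where
  "scan_vertex \<beta> r =
     (Instr (Mult 6 (Reg 3) (Reg 0)) ;; Instr (Move 11 (Imm 0)) ;; Instr (Move 12 (Imm 1))) ;;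
     for_loop 4 (scan_neighbour \<beta>) ;;
     If (Equal (Reg 12) (Imm 0)) Skip
       (If (Less (Reg 11) (Reg 13))
         (Instr (Move 13 (Reg 11)) ;; Instr (Add r (Reg 3) (Imm 1))) Skip)"

definition copy_entry :: prog where
  "copy_entry = read_entry 9 6 4 ;; Instr (Add 8 (Reg 14) (Reg 4)) ;; Instr (Store (Reg 8) (Reg 9))"

text \<open>
  The initial bound \<open>n\<close> exceeds every degree, so the first homogeneous neighbourhood is always
  recorded.
\<close>
definition search :: "bool \<Rightarrow> nat \<Rightarrow> prog" where
  "search \<beta> r =
     (Instr (Move r (Imm 0)) ;; Instr (Move 13 (Reg 0))) ;;
     for_loop 3 (scan_vertex \<beta> r) ;;
     If (Equal (Reg r) (Imm 0)) Skip
       ((Instr (Sub 3 (Reg r) (Imm 1)) ;; Instr (Mult 6 (Reg 3) (Reg 0))) ;;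
        for_loop 4 copy_entry)"

definition separators :: prog where
  "separators =
     If (Equal (Reg 0) (Imm 1))
       (Instr (Move 1 (Imm 1)) ;; Instr (Move 2 (Imm 1)) ;;
        Instr (Store (Imm 1) (Imm 1)) ;; Instr (Store (Imm 2) (Imm 1)))
       (Instr (Mult 14 (Reg 0) (Reg 0)) ;; search True 1 ;;
        Instr (Add 14 (Reg 14) (Reg 0)) ;; search False 2)"

section \<open>Correctness and running time of the search\<close>

definition same_except :: "nat set \<Rightarrow> state \<Rightarrow> state \<Rightarrow> bool" where
  "same_except X s s' \<longleftrightarrow> mem s' = mem s \<and> (\<forall>j. j \<notin> X \<longrightarrow> reg s' j = reg s j)"

lemma same_except_refl [simp]: "same_except X s s"
  by (simp add: same_except_def)

lemma same_except_set_reg [simp]: "i \<in> X \<Longrightarrow> same_except X s (set_reg i x s') \<longleftrightarrow> same_except X s s'"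
  by (auto simp: same_except_def)

lemma same_except_trans:
  "same_except X s s' \<Longrightarrow> same_except Y s' s'' \<Longrightarrow> X \<union> Y \<subseteq> Z \<Longrightarrow> same_except Z s s''"
  unfolding same_except_def by (metis Un_iff subsetD)

lemma same_except_mem: "same_except X s s' \<Longrightarrow> mem s' = mem s"
  by (simp add: same_except_def)

lemma entry_bound: "v < n \<Longrightarrow> w < n \<Longrightarrow> v * n + w < n * (n::nat)"
proof -
  assume "v < n" "w < n"
  then have "v * n + w < Suc v * n" by simp
  also have "\<dots> \<le> n * n" using \<open>v < n\<close> by (intro mult_le_mono1) simp
  finally show ?thesis .
qed

text \<open>
  The word bound has to cover the addresses of the matrix and of the two characteristic vectors
  behind it.
\<close>
locale adjacency_matrix =
  fixes n :: nat and E :: "nat \<Rightarrow> nat \<Rightarrow> bool" and W :: nat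
  assumes n_pos: "0 < n" and irrefl: "\<not> E v v" and W: "n * n + 2 * n \<le> W"
begin

definition matrix :: "state \<Rightarrow> bool" where
  "matrix s \<longleftrightarrow> reg s 0 = n \<and> (\<forall>v < n. \<forall>w < n. mem s (v * n + w) = of_bool (E v w))"

definition nb :: "nat \<Rightarrow> nat set" where
  "nb v = {u. u < n \<and> E v u}"

definition homog :: "bool \<Rightarrow> nat \<Rightarrow> bool" where
  "homog \<beta> v \<longleftrightarrow> (\<forall>u \<in> nb v. \<forall>w \<in> nb v. w \<noteq> u \<longrightarrow> (E u w \<longleftrightarrow> \<beta>))"

lemma entry_le_W: "v < n \<Longrightarrow> w < n \<Longrightarrow> v * n + w \<le> W"
  using entry_bound[of v n w] W by linarith

lemma n_le_W: "n \<le> W"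
  using W by linarith

lemma W_pos: "Suc 0 \<le> W"
  using W n_pos by linarith

lemma row_le_W: "v < n \<Longrightarrow> v * n \<le> W"
  using entry_le_W[of v 0] n_pos by simp

text \<open>
  The test \<open>w \<noteq> u\<close> is needed because the diagonal entry of \<open>u\<close> is 0, which a clique search would
  take for a missing edge.
\<close>
lemma runs_scan_pairs:
  assumes s: "within_words W s" "matrix s" "reg s 4 = u" "reg s 6 = v * n" "reg s 7 = u * n"
    and uv: "u < n" "v < n"
  shows "runs W (for_loop 5 (scan_pair \<beta>)) s (2 + 10 * n)
    (\<lambda>s'. same_except {5, 8, 9, 10, 12} s s' \<and>
      (reg s' 12 \<noteq> 0 \<longleftrightarrow> reg s 12 \<noteq> 0 \<and> (\<forall>w < n. E v w \<and> w \<noteq> u \<longrightarrow> (E u w \<longleftrightarrow> \<beta>))))"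
proof -
  let ?I = "\<lambda>k s'. same_except {5, 8, 9, 10, 12} s s' \<and>
      (reg s' 12 \<noteq> 0 \<longleftrightarrow> reg s 12 \<noteq> 0 \<and> (\<forall>w < k. E v w \<and> w \<noteq> u \<longrightarrow> (E u w \<longleftrightarrow> \<beta>)))"
  have "runs W (for_loop 5 (scan_pair \<beta>)) s (2 + (\<Sum>k<n. 8 + 2)) (?I n)"
  proof (rule runs_for_loop[where I = ?I and c = "\<lambda>_. 8"])
    show "reg s 0 = n" "n \<le> W" "within_words W s" using s n_le_W by (auto simp: matrix_def)
    show "?I 0 (set_reg 5 0 s)" by simp
    fix w s' assume w: "w < n" and s': "within_words W s'" "reg s' 0 = n" "reg s' 5 = w" "?I w s'"
    have frame: "reg s' 4 = u" "reg s' 6 = v * n" "reg s' 7 = u * n" "mem s' = mem s"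
      using s'(4) s by (auto simp: same_except_def)
    have entries: "mem s (v * n + w) = of_bool (E v w)" "mem s (u * n + w) = of_bool (E u w)"
      using s(2) w uv by (auto simp: matrix_def)
    have "wp W (scan_pair \<beta>) (\<lambda>s''. reg s'' 0 = n \<and> reg s'' 5 = w \<and> ?I (Suc w) (set_reg 5 (Suc w) s'')) s'"
      using s' w uv
      by (auto simp: scan_pair_def read_entry_def frame entries entry_le_W less_Suc_eq W_pos)
    from s'(1) this
    show "runs W (scan_pair \<beta>) s' 8 (\<lambda>s''. reg s'' 0 = n \<and> reg s'' 5 = w \<and> ?I (Suc w) (set_reg 5 (Suc w) s''))"
      by (rule runs_straight_line) (simp add: scan_pair_def read_entry_def)
  qed simp
  then show ?thesis by (rule runs_mono) auto
qed

lemma card_nb_less: "v < n \<Longrightarrow> card (nb v) < n"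
proof -
  assume "v < n"
  then have "nb v \<subset> {..<n}" using irrefl by (auto simp: nb_def)
  from psubset_card_mono[OF _ this] show ?thesis by simp
qed

lemma card_Collect_Suc:
  "card {u. u < Suc k \<and> P u} = card {u. u < k \<and> P u} + of_bool (P k)"
proof -
  have "{u. u < Suc k \<and> P u} = (if P k then insert k {u. u < k \<and> P u} else {u. u < k \<and> P u})"
    by (auto simp: less_Suc_eq)
  then show ?thesis by simp
qed

text \<open>
  The inner loop runs only for neighbours of \<open>v\<close>; this is where the factor \<open>\<Delta>\<close> instead of \<open>n\<close> in
  the running time comes from.
\<close>
lemma runs_scan_neighbours:
  assumes s: "within_words W s" "matrix s" "reg s 6 = v * n" "reg s 11 = 0" "reg s 12 = 1"
    and v: "v < n"
  shows "runs W (for_loop 4 (scan_neighbour \<beta>)) s (2 + 6 * n + card (nb v) * (3 + 10 * n))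
    (\<lambda>s'. same_except {4, 5, 7, 8, 9, 10, 11, 12} s s' \<and> reg s' 11 = card (nb v) \<and>
      (reg s' 12 \<noteq> 0 \<longleftrightarrow> homog \<beta> v))"
proof -
  let ?X = "{4, 5, 7, 8, 9, 10, 11, 12}"
  let ?H = "\<lambda>u. \<forall>w < n. E v w \<and> w \<noteq> u \<longrightarrow> (E u w \<longleftrightarrow> \<beta>)"
  let ?I = "\<lambda>k s'. same_except ?X s s' \<and> reg s' 11 = card {u. u < k \<and> E v u} \<and>
      (reg s' 12 \<noteq> 0 \<longleftrightarrow> (\<forall>u < k. E v u \<longrightarrow> ?H u))"
  let ?c = "\<lambda>k. 4 + of_bool (E v k) * (3 + 10 * n)"
  have "runs W (for_loop 4 (scan_neighbour \<beta>)) s (2 + (\<Sum>k<n. ?c k + 2)) (?I n)"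
  proof (rule runs_for_loop[where I = ?I and c = ?c])
    show "reg s 0 = n" "n \<le> W" "within_words W s" using s n_le_W by (auto simp: matrix_def)
    show "?I 0 (set_reg 4 0 s)" using s by simp
    fix u s' assume u: "u < n" and s': "within_words W s'" "reg s' 0 = n" "reg s' 4 = u" "?I u s'"
    have frame: "reg s' 6 = v * n" "mem s' = mem s" and same: "same_except ?X s s'"
      using s'(4) s by (auto simp: same_except_def)
    have entry: "mem s (v * n + u) = of_bool (E v u)"
      using s(2) u v by (auto simp: matrix_def)
    let ?Q = "\<lambda>s''. reg s'' 0 = n \<and> reg s'' 4 = u \<and> ?I (Suc u) (set_reg 4 (Suc u) s'')"
    let ?R = "\<lambda>s''. same_except {8, 9} s' s'' \<and> reg s'' 9 = of_bool (E v u)"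
    show "runs W (scan_neighbour \<beta>) s' (?c u) ?Q"
    proof (cases "E v u")
      case False
      have "runs W (scan_neighbour \<beta>) s' (2 + (1 + 1)) ?Q"
        unfolding scan_neighbour_def
      proof (rule runs_Seq)
        have "wp W (read_entry 9 6 4) ?R s'"
          using s' u v by (simp add: read_entry_def frame entry entry_le_W W_pos)
        with s'(1) show "runs W (read_entry 9 6 4) s' 2 ?R"
          by (rule runs_straight_line) (simp add: read_entry_def)
        fix s1 assume s1: "within_words W s1" "?R s1"
        have "same_except ?X s s1" using same s1(2) by (auto intro: same_except_trans)
        moreover have "reg s1 j = reg s' j" if "j \<notin> {8, 9}" for j
          using s1(2) that by (auto simp: same_except_def)
        ultimately have "?Q s1" using s' False by (simp add: card_Collect_Suc All_less_Suc)
        show "runs W (If (Equal (Reg 9) (Imm 0)) Skip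
            ((Instr (Add 11 (Reg 11) (Imm 1)) ;; Instr (Mult 7 (Reg 4) (Reg 0))) ;;
             for_loop 5 (scan_pair \<beta>))) s1 (1 + 1) ?Q"
        proof (rule runs_If)
          show "runs W Skip s1 1 ?Q" by (rule runsI[OF exec.Skip _ s1(1)]) (simp, fact)
        qed (use s1 False in simp)
      qed
      then show ?thesis by (rule runs_mono) (use False in auto)
    next
      case True
      have deg: "card {u'. u' < u \<and> E v u'} < n"
      proof -
        have "card {u'. u' < u \<and> E v u'} \<le> card {..<u}" by (intro card_mono) auto
        then show ?thesis using u by simp
      qed
      have "runs W (scan_neighbour \<beta>) s' (2 + (1 + (2 + (2 + 10 * n)))) ?Q"
        unfolding scan_neighbour_def
      proof (rule runs_Seq)
        have "wp W (read_entry 9 6 4) ?R s'"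
          using s' u v by (simp add: read_entry_def frame entry entry_le_W W_pos)
        with s'(1) show "runs W (read_entry 9 6 4) s' 2 ?R"
          by (rule runs_straight_line) (simp add: read_entry_def)
        fix s1 assume s1: "within_words W s1" "?R s1"
        have same1: "same_except ?X s s1" using same s1(2) by (auto intro: same_except_trans)
        have regs1: "reg s1 j = reg s' j" if "j \<notin> {8, 9}" for j
          using s1(2) that by (auto simp: same_except_def)
        let ?p = "Instr (Add 11 (Reg 11) (Imm 1)) ;; Instr (Mult 7 (Reg 4) (Reg 0))"
        show "runs W (If (Equal (Reg 9) (Imm 0)) Skip (?p ;; for_loop 5 (scan_pair \<beta>))) s1
            (1 + (2 + (2 + 10 * n))) ?Q"
        proof (rule runs_If)
          let ?s2 = "set_reg 7 (u * n) (set_reg 11 (reg s' 11 + 1) s1)"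
          show "runs W (?p ;; for_loop 5 (scan_pair \<beta>)) s1 (2 + (2 + 10 * n)) ?Q"
          proof (rule runs_Seq)
            have "wp W ?p (\<lambda>s2. s2 = ?s2) s1"
              using s' s1 u deg n_le_W row_le_W[OF u] by (simp add: regs1)
            with s1(1) show "runs W ?p s1 2 (\<lambda>s2. s2 = ?s2)"
              by (rule runs_straight_line) simp
            fix s2 assume s2: "within_words W s2" "s2 = ?s2"
            have same2: "same_except ?X s s2" using same1 s2 by simp
            have "matrix s2" using s(2) same2 by (simp add: matrix_def same_except_def)
            moreover have "reg s2 4 = u" "reg s2 6 = v * n" "reg s2 7 = u * n"
              using s2(2) s'(3) frame by (simp_all add: regs1)
            ultimately have "runs W (for_loop 5 (scan_pair \<beta>)) s2 (2 + 10 * n)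
                (\<lambda>s3. same_except {5, 8, 9, 10, 12} s2 s3 \<and> (reg s3 12 \<noteq> 0 \<longleftrightarrow> reg s2 12 \<noteq> 0 \<and> ?H u))"
              by (intro runs_scan_pairs) (use u v s2 in auto)
            then show "runs W (for_loop 5 (scan_pair \<beta>)) s2 (2 + 10 * n) ?Q"
            proof (rule runs_mono)
              fix s3 assume s3: "same_except {5, 8, 9, 10, 12} s2 s3 \<and> (reg s3 12 \<noteq> 0 \<longleftrightarrow> reg s2 12 \<noteq> 0 \<and> ?H u)"
              have "same_except ?X s s3" using same2 s3 by (auto intro: same_except_trans)
              moreover have "reg s3 0 = n" "reg s3 4 = u" "reg s3 11 = reg s' 11 + 1"
                using s3 s2(2) s' by (auto simp: same_except_def regs1)
              moreover have "reg s3 12 \<noteq> 0 \<longleftrightarrow> reg s' 12 \<noteq> 0 \<and> ?H u"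
                using s3 s2(2) by (simp add: regs1)
              ultimately show "?Q s3"
                using s'(4) True by (auto simp: card_Collect_Suc All_less_Suc)
            qed simp
          qed
        qed (use s1 True in simp)
      qed
      then show ?thesis by (rule runs_mono) (use True in auto)
    qed
  qed simp
  then show ?thesis
  proof (rule runs_mono)
    have "(\<Sum>k<n. of_bool (E v k)) = card (nb v)"
      by (simp add: nb_def Int_def)
    then show "2 + (\<Sum>k<n. ?c k + 2) \<le> 2 + 6 * n + card (nb v) * (3 + 10 * n)"
      by (simp add: sum.distrib sum_distrib_right[symmetric])
    show "same_except ?X s s' \<and> reg s' 11 = card (nb v) \<and> (reg s' 12 \<noteq> 0 \<longleftrightarrow> homog \<beta> v)"
      if "?I n s'" for s'
      using that by (auto simp: nb_def homog_def)
  qed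
qed

lemma runs_scan_vertex:
  assumes s: "within_words W s" "matrix s" "reg s 3 = v" and v: "v < n" and r: "r \<in> {1, 2}"
  shows "runs W (scan_vertex \<beta> r) s (9 + 6 * n + card (nb v) * (3 + 10 * n))
    (\<lambda>s'. same_except {r, 4, 5, 6, 7, 8, 9, 10, 11, 12, 13} s s' \<and>
      (if homog \<beta> v \<and> card (nb v) < reg s 13 then reg s' 13 = card (nb v) \<and> reg s' r = Suc v
       else reg s' 13 = reg s 13 \<and> reg s' r = reg s r))"
    (is "runs W _ s ?T ?Q")
proof -
  let ?L = "2 + 6 * n + card (nb v) * (3 + 10 * n)"
  let ?s1 = "set_reg 12 1 (set_reg 11 0 (set_reg 6 (v * n) s))"
  have "runs W (scan_vertex \<beta> r) s (3 + (?L + 4)) ?Q"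
    unfolding scan_vertex_def
  proof (rule runs_Seq)
    show "runs W (Instr (Mult 6 (Reg 3) (Reg 0)) ;; Instr (Move 11 (Imm 0)) ;; Instr (Move 12 (Imm 1)))
        s 3 (\<lambda>s1. s1 = ?s1)"
      using s row_le_W[OF v] W_pos
      by (intro runs_straight_line) (simp_all add: matrix_def)
    fix s1 assume s1: "within_words W s1" "s1 = ?s1"
    have same1: "same_except {6, 11, 12} s s1" using s1 by simp
    have "matrix s1" using s(2) s1 by (simp add: matrix_def)
    then have loop: "runs W (for_loop 4 (scan_neighbour \<beta>)) s1 ?L
        (\<lambda>s2. same_except {4, 5, 7, 8, 9, 10, 11, 12} s1 s2 \<and> reg s2 11 = card (nb v) \<and>
          (reg s2 12 \<noteq> 0 \<longleftrightarrow> homog \<beta> v))"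
      by (intro runs_scan_neighbours) (use s1 v in auto)
    show "runs W (for_loop 4 (scan_neighbour \<beta>) ;;
        If (Equal (Reg 12) (Imm 0)) Skip
          (If (Less (Reg 11) (Reg 13))
            (Instr (Move 13 (Reg 11)) ;; Instr (Add r (Reg 3) (Imm 1))) Skip)) s1 (?L + 4) ?Q"
    proof (rule runs_Seq[OF loop])
      fix s2 assume s2: "within_words W s2"
        "same_except {4, 5, 7, 8, 9, 10, 11, 12} s1 s2 \<and> reg s2 11 = card (nb v) \<and>
          (reg s2 12 \<noteq> 0 \<longleftrightarrow> homog \<beta> v)"
      have same2: "same_except {r, 4, 5, 6, 7, 8, 9, 10, 11, 12, 13} s s2"
        using same1 s2(2) by (auto intro: same_except_trans)
      have regs2: "reg s2 3 = v" "reg s2 13 = reg s 13" "reg s2 r = reg s r"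
        using s1(2) s2(2) s(3) r by (auto simp: same_except_def)
      have "card (nb v) \<le> W" "Suc v \<le> W" using card_nb_less[OF v] v n_le_W by auto
      then show "runs W (If (Equal (Reg 12) (Imm 0)) Skip
          (If (Less (Reg 11) (Reg 13))
            (Instr (Move 13 (Reg 11)) ;; Instr (Add r (Reg 3) (Imm 1))) Skip)) s2 4 ?Q"
        using s2 same2 regs2 r by (intro runs_straight_line) auto
    qed
  qed
  then show ?thesis by (rule runs_mono) auto
qed

text \<open>The loop invariant of the search after the vertices below \<open>k\<close>.\<close>
definition best_among :: "bool \<Rightarrow> nat \<Rightarrow> nat \<Rightarrow> state \<Rightarrow> bool" where
  "best_among \<beta> r k s \<longleftrightarrow>
     reg s r = 0 \<and> reg s 13 = n \<and> (\<forall>v < k. \<not> homog \<beta> v) \<or>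
     (\<exists>b < k. reg s r = Suc b \<and> homog \<beta> b \<and> reg s 13 = card (nb b) \<and>
       (\<forall>v < k. homog \<beta> v \<longrightarrow> card (nb b) \<le> card (nb v)))"

lemma best_among_Suc:
  assumes "best_among \<beta> r v s" "v < n"
    and "if homog \<beta> v \<and> card (nb v) < reg s 13 then reg s' 13 = card (nb v) \<and> reg s' r = Suc v
       else reg s' 13 = reg s 13 \<and> reg s' r = reg s r"
  shows "best_among \<beta> r (Suc v) s'"
proof -
  from assms(1)[unfolded best_among_def] show ?thesis
  proof (elim disjE exE conjE)
    assume "reg s r = 0" "reg s 13 = n" "\<forall>v' < v. \<not> homog \<beta> v'"
    then show ?thesis
      using assms(2,3) card_nb_less[of v]
      by (auto simp: best_among_def All_less_Suc split: if_splits)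
  next
    fix b assume some: "b < v" "reg s r = Suc b" "homog \<beta> b" "reg s 13 = card (nb b)"
      "\<forall>v' < v. homog \<beta> v' \<longrightarrow> card (nb b) \<le> card (nb v')"
    show ?thesis
    proof (cases "homog \<beta> v \<and> card (nb v) < card (nb b)")
      case True
      then have "reg s' 13 = card (nb v)" "reg s' r = Suc v" using assms(3) some by auto
      moreover have "\<forall>v' < Suc v. homog \<beta> v' \<longrightarrow> card (nb v) \<le> card (nb v')"
        using some(5) True unfolding All_less_Suc by (meson le_trans less_imp_le order_refl)
      ultimately show ?thesis unfolding best_among_def using True by blast
    next
      case False
      then have "reg s' 13 = card (nb b)" "reg s' r = Suc b" using assms(3) some by auto
      moreover have "\<forall>v' < Suc v. homog \<beta> v' \<longrightarrow> card (nb b) \<le> card (nb v')"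
        using some(5) False by (auto simp: All_less_Suc)
      ultimately show ?thesis unfolding best_among_def using some(1,3) less_SucI by blast
    qed
  qed
qed

lemma runs_scan_vertices:
  assumes s: "within_words W s" "matrix s" "reg s r = 0" "reg s 13 = n" and r: "r \<in> {1, 2}"
    and D: "\<And>v. v < n \<Longrightarrow> card (nb v) \<le> D"
  shows "runs W (for_loop 3 (scan_vertex \<beta> r)) s (2 + n * (11 + 6 * n + D * (3 + 10 * n)))
    (\<lambda>s'. same_except {r, 3, 4, 5, 6, 7, 8, 9, 10, 11, 12, 13} s s' \<and> best_among \<beta> r n s')"
proof -
  let ?X = "{r, 3, 4, 5, 6, 7, 8, 9, 10, 11, 12, 13}"
  let ?I = "\<lambda>k s'. same_except ?X s s' \<and> best_among \<beta> r k s'"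
  let ?c = "9 + 6 * n + D * (3 + 10 * n)"
  have set3: "best_among \<beta> r k (set_reg 3 x s') \<longleftrightarrow> best_among \<beta> r k s'" for k x s'
    using r by (auto simp: best_among_def)
  have "runs W (for_loop 3 (scan_vertex \<beta> r)) s (2 + (\<Sum>k<n. ?c + 2)) (?I n)"
  proof (rule runs_for_loop[where I = ?I and c = "\<lambda>_. ?c"])
    show "reg s 0 = n" "n \<le> W" "within_words W s" using s n_le_W by (auto simp: matrix_def)
    show "?I 0 (set_reg 3 0 s)" using s by (simp add: set3) (simp add: best_among_def)
    fix v s' assume v: "v < n" and s': "within_words W s'" "reg s' 0 = n" "reg s' 3 = v" "?I v s'"
    have "matrix s'" using s(2) s'(2) same_except_mem[OF conjunct1[OF s'(4)]] by (simp add: matrix_def)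
    from runs_scan_vertex[OF s'(1) this s'(3) v r]
    show "runs W (scan_vertex \<beta> r) s' ?c
        (\<lambda>s''. reg s'' 0 = n \<and> reg s'' 3 = v \<and> ?I (Suc v) (set_reg 3 (Suc v) s''))"
    proof (rule runs_mono)
      show "9 + 6 * n + card (nb v) * (3 + 10 * n) \<le> ?c"
        using D[OF v] by (intro add_left_mono mult_le_mono1)
      fix s'' assume s'': "same_except {r, 4, 5, 6, 7, 8, 9, 10, 11, 12, 13} s' s'' \<and>
        (if homog \<beta> v \<and> card (nb v) < reg s' 13 then reg s'' 13 = card (nb v) \<and> reg s'' r = Suc v
         else reg s'' 13 = reg s' 13 \<and> reg s'' r = reg s' r)"
      have "same_except ?X s s''" using s'(4) s'' by (auto intro: same_except_trans)
      moreover have "reg s'' 0 = n" "reg s'' 3 = v" using s'' s' r by (auto simp: same_except_def)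
      moreover have "best_among \<beta> r (Suc v) s''"
        by (rule best_among_Suc[OF _ v, of _ _ s']) (use s'(4) s'' in auto)
      ultimately show "reg s'' 0 = n \<and> reg s'' 3 = v \<and> ?I (Suc v) (set_reg 3 (Suc v) s'')"
        by (simp add: set3)
    qed
  qed simp
  then show ?thesis by (rule runs_mono) (simp_all add: algebra_simps)
qed

text \<open>Reading and writing do not interfere, because the output lies behind the matrix: \<open>n * n \<le> a\<close>.\<close>
lemma runs_copy_row:
  assumes s: "within_words W s" "matrix s" "reg s 6 = b * n" "reg s 14 = a"
    and b: "b < n" and a: "n * n \<le> a" "a + n \<le> W"
  shows "runs W (for_loop 4 copy_entry) s (2 + 6 * n)
    (\<lambda>s'. (\<forall>j. j \<notin> {4, 8, 9} \<longrightarrow> reg s' j = reg s j) \<and>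
      (\<forall>x. mem s' x = (if a \<le> x \<and> x < a + n then of_bool (E b (x - a)) else mem s x)))"
proof -
  let ?I = "\<lambda>k s'. (\<forall>j. j \<notin> {4, 8, 9} \<longrightarrow> reg s' j = reg s j) \<and>
      (\<forall>x. mem s' x = (if a \<le> x \<and> x < a + k then of_bool (E b (x - a)) else mem s x))"
  have "runs W (for_loop 4 copy_entry) s (2 + (\<Sum>k<n. 4 + 2)) (?I n)"
  proof (rule runs_for_loop[where I = ?I and c = "\<lambda>_. 4"])
    show "reg s 0 = n" "n \<le> W" "within_words W s" using s n_le_W by (auto simp: matrix_def)
    show "?I 0 (set_reg 4 0 s)" by auto
    fix u s' assume u: "u < n" and s': "within_words W s'" "reg s' 0 = n" "reg s' 4 = u" "?I u s'"
    have "b * n + u < n * n" using entry_bound b u by simp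
    then have entry: "mem s' (b * n + u) = of_bool (E b u)"
      using s'(4) s(2) b u a by (auto simp: matrix_def)
    have regs: "reg s' 6 = b * n" "reg s' 14 = a" using s'(4) s by auto
    let ?s2 = "set_reg 8 (a + u) (set_reg 9 (of_bool (E b u)) (set_reg 8 (b * n + u) s'))"
    let ?s3 = "?s2\<lparr>mem := (mem s')(a + u := of_bool (E b u))\<rparr>"
    have "a + u \<le> W" using a u by simp
    then have "wp W copy_entry (\<lambda>s''. s'' = ?s3) s'"
      using s'(1,3) u b W_pos
      by (simp add: copy_entry_def read_entry_def regs entry entry_le_W)
    with s'(1) have run: "runs W copy_entry s' 4 (\<lambda>s''. s'' = ?s3)"
      by (rule runs_straight_line) (simp add: copy_entry_def read_entry_def)
    have "mem ?s3 x = (if a \<le> x \<and> x < a + Suc u then of_bool (E b (x - a)) else mem s x)" for x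
      using s'(4) by (cases "x = a + u") auto
    then have "?I (Suc u) (set_reg 4 (Suc u) ?s3)"
      using s'(4) by simp
    then show "runs W copy_entry s' 4
        (\<lambda>s''. reg s'' 0 = n \<and> reg s'' 4 = u \<and> ?I (Suc u) (set_reg 4 (Suc u) s''))"
      using s'(2,3) by (intro runs_mono[OF run]) simp_all
  qed simp
  then show ?thesis by (rule runs_mono) auto
qed

lemma min_card_answer_best_among:
  assumes best: "best_among \<beta> r n s"
    and out: "\<And>b. reg s r = Suc b \<Longrightarrow> b < n \<Longrightarrow> reg s' r = Suc b \<and> (\<forall>u < n. mem s' (a + u) = of_bool (E b u))"
    and none: "reg s r = 0 \<Longrightarrow> reg s' r = 0"
  shows "min_card_answer (\<lambda>R. \<exists>v < n. R = nb v \<and> homog \<beta> v) (output_set n r a s')"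
  using best unfolding best_among_def
proof (elim disjE exE conjE)
  assume "reg s r = 0" "\<forall>v < n. \<not> homog \<beta> v"
  then show ?thesis using none by (simp add: min_card_answer_def output_set_def)
next
  fix b assume b: "b < n" "reg s r = Suc b" "homog \<beta> b"
    "\<forall>v < n. homog \<beta> v \<longrightarrow> card (nb b) \<le> card (nb v)"
  have "output_set n r a s' = Some (nb b)"
    using out[OF b(2,1)] by (auto simp: output_set_def nb_def)
  moreover have "is_arg_min card (\<lambda>R. \<exists>v < n. R = nb v \<and> homog \<beta> v) (nb b)"
    using b by (auto simp: is_arg_min_def not_less)
  ultimately show ?thesis by (simp add: min_card_answer_def)
qed

text \<open>
  The frame conditions let two searches run one after the other: the matrix survives for the
  second one, and the second one leaves the result register and the vector of the first alone.
\<close>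
lemma runs_search:
  assumes s: "within_words W s" "matrix s" "reg s 14 = a" and a: "n * n \<le> a" "a + n \<le> W"
    and r: "r \<in> {1, 2}" and D: "\<And>v. v < n \<Longrightarrow> card (nb v) \<le> D" "0 < D"
  shows "runs W (search \<beta> r) s (45 * (n ^ 2 * D))
    (\<lambda>s'. matrix s' \<and> (\<forall>j. j \<in> {1, 2, 14} - {r} \<longrightarrow> reg s' j = reg s j) \<and>
      (\<forall>x. x < a \<or> a + n \<le> x \<longrightarrow> mem s' x = mem s x) \<and>
      min_card_answer (\<lambda>R. \<exists>v < n. R = nb v \<and> homog \<beta> v) (output_set n r a s'))"
    (is "runs W _ s _ ?Q")
proof -
  let ?L = "2 + n * (11 + 6 * n + D * (3 + 10 * n))"
  let ?s1 = "set_reg 13 n (set_reg r 0 s)"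
  have reg0: "reg s 0 = n" using s(2) by (simp add: matrix_def)
  have "runs W (search \<beta> r) s (2 + (?L + (1 + (2 + (2 + 6 * n))))) ?Q"
    unfolding search_def
  proof (rule runs_Seq)
    show "runs W (Instr (Move r (Imm 0)) ;; Instr (Move 13 (Reg 0))) s 2 (\<lambda>s1. s1 = ?s1)"
      using s r reg0 n_le_W by (intro runs_straight_line) auto
    fix s1 assume s1: "within_words W s1" "s1 = ?s1"
    have "matrix s1" using s(2) s1 r by (auto simp: matrix_def)
    then have loop: "runs W (for_loop 3 (scan_vertex \<beta> r)) s1 ?L
      (\<lambda>s2. same_except {r, 3, 4, 5, 6, 7, 8, 9, 10, 11, 12, 13} s1 s2 \<and> best_among \<beta> r n s2)"
      by (intro runs_scan_vertices) (use s1 r D in auto)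
    let ?p = "Instr (Sub 3 (Reg r) (Imm 1)) ;; Instr (Mult 6 (Reg 3) (Reg 0))"
    show "runs W (for_loop 3 (scan_vertex \<beta> r) ;;
        If (Equal (Reg r) (Imm 0)) Skip (?p ;; for_loop 4 copy_entry)) s1
        (?L + (1 + (2 + (2 + 6 * n)))) ?Q"
    proof (rule runs_Seq[OF loop])
      fix s2 assume s2: "within_words W s2"
        "same_except {r, 3, 4, 5, 6, 7, 8, 9, 10, 11, 12, 13} s1 s2 \<and> best_among \<beta> r n s2"
      have best: "best_among \<beta> r n s2" using s2 by simp
      have mem2: "mem s2 = mem s" using s1(2) same_except_mem[OF conjunct1[OF s2(2)]] by simp
      have regs2: "reg s2 j = reg s j" if "j \<notin> {r, 3, 4, 5, 6, 7, 8, 9, 10, 11, 12, 13}" for j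
        using s2(2) s1(2) that by (auto simp: same_except_def)
      have reg20: "reg s2 0 = n" using regs2[of 0] r reg0 by auto
      have mat2: "matrix s2" using s(2) mem2 reg20 by (simp add: matrix_def)
      have frame2: "reg s2 j = reg s j" if "j \<in> {1, 2, 14} - {r}" for j
        using that by (intro regs2) auto
      show "runs W (If (Equal (Reg r) (Imm 0)) Skip (?p ;; for_loop 4 copy_entry)) s2
          (1 + (2 + (2 + 6 * n))) ?Q"
      proof (rule runs_If)
        assume "holds (Equal (Reg r) (Imm 0)) s2"
        then have "reg s2 r = 0" by simp
        then have "min_card_answer (\<lambda>R. \<exists>v < n. R = nb v \<and> homog \<beta> v) (output_set n r a s2)"
          by (intro min_card_answer_best_among[OF best]) auto
        then show "runs W Skip s2 (2 + (2 + 6 * n)) ?Q"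
          using s2(1) mat2 frame2 mem2 by (intro runs_straight_line) auto
      next
        assume "\<not> holds (Equal (Reg r) (Imm 0)) s2"
        then obtain b where b: "reg s2 r = Suc b" "b < n"
          using best unfolding best_among_def by auto
        let ?s3 = "set_reg 6 (b * n) (set_reg 3 b s2)"
        show "runs W (?p ;; for_loop 4 copy_entry) s2 (2 + (2 + 6 * n)) ?Q"
        proof (rule runs_Seq)
          show "runs W ?p s2 2 (\<lambda>s3. s3 = ?s3)"
            using s2(1) b n_le_W row_le_W[OF b(2)] reg20 r by (intro runs_straight_line) auto
          fix s3 assume s3: "within_words W s3" "s3 = ?s3"
          have "matrix s3" using mat2 s3 by (simp add: matrix_def)
          moreover have "reg s3 6 = b * n" "reg s3 14 = a"
            using s3 frame2[of 14] s(3) r by auto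
          ultimately have "runs W (for_loop 4 copy_entry) s3 (2 + 6 * n)
            (\<lambda>s4. (\<forall>j. j \<notin> {4, 8, 9} \<longrightarrow> reg s4 j = reg s3 j) \<and>
              (\<forall>x. mem s4 x = (if a \<le> x \<and> x < a + n then of_bool (E b (x - a)) else mem s3 x)))"
            by (intro runs_copy_row) (use s3 b a in auto)
          then show "runs W (for_loop 4 copy_entry) s3 (2 + 6 * n) ?Q"
          proof (rule runs_mono)
            fix s4 :: state assume s4: "(\<forall>j. j \<notin> {4, 8, 9} \<longrightarrow> reg s4 j = reg s3 j) \<and>
              (\<forall>x. mem s4 x = (if a \<le> x \<and> x < a + n then of_bool (E b (x - a)) else mem s3 x))"
            have mem4: "mem s4 x = mem s x" if "x < a \<or> a + n \<le> x" for x
              using s4 s3 mem2 that by auto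
            have regs4: "reg s4 j = reg s2 j" if "j \<notin> {3, 4, 6, 8, 9}" for j
              using s4 s3 that by auto
            have "matrix s4"
              unfolding matrix_def
            proof (intro conjI allI impI)
              show "reg s4 0 = n" using regs4[of 0] reg20 by simp
              fix v w assume vw: "v < n" "w < n"
              then have "mem s4 (v * n + w) = mem s (v * n + w)"
                using entry_bound[OF vw] a by (intro mem4) simp
              then show "mem s4 (v * n + w) = of_bool (E v w)" using s(2) vw by (simp add: matrix_def)
            qed
            moreover have "reg s4 j = reg s j" if "j \<in> {1, 2, 14} - {r}" for j
              using that frame2[OF that] regs4[of j] by auto
            moreover have "min_card_answer (\<lambda>R. \<exists>v < n. R = nb v \<and> homog \<beta> v) (output_set n r a s4)"
            proof (rule min_card_answer_best_among[OF best])
              have rr: "reg s4 r = reg s2 r" using r by (intro regs4) auto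
              show "reg s4 r = Suc b' \<and> (\<forall>u < n. mem s4 (a + u) = of_bool (E b' u))"
                if "reg s2 r = Suc b'" for b'
                using that b rr s4 by auto
              show "reg s4 r = 0" if "reg s2 r = 0" using that rr by simp
            qed
            ultimately show "?Q s4" using mem4 by blast
          qed simp
        qed
      qed
    qed
  qed
  then show ?thesis
  proof (rule runs_mono)
    have "n \<le> n * n * D" "n * n \<le> n * n * D" "n * D \<le> n * n * D" "1 \<le> n * n * D"
      using n_pos D(2) by simp_all
    moreover have "2 + (?L + (1 + (2 + (2 + 6 * n)))) = 9 + 17 * n + 6 * (n * n) + 3 * (n * D) + 10 * (n * n * D)"
      by (simp add: algebra_simps)
    ultimately show "2 + (?L + (1 + (2 + (2 + 6 * n)))) \<le> 45 * (n ^ 2 * D)"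
      unfolding power2_eq_square by linarith
  qed
qed

end

section \<open>Both searches on a graph\<close>

lemma pair_graph_out_degree:
  assumes "pair_graph G"
  shows "out_degree (with_proj G) v = card {u. (v, u) \<in> parcs G}"
proof -
  have "out_arcs (with_proj G) v = Pair v ` {u. (v, u) \<in> parcs G}"
    by (auto simp: out_arcs_def)
  then show ?thesis by (simp add: out_degree_def card_image inj_on_def)
qed

lemma runs_separators:
  assumes G: "pair_graph G" "pverts G = {..<n}" "two_K2_free (with_proj G)" and n: "n \<noteq> 0" "n \<noteq> 1"
  shows "runs (100 * n ^ 2) separators (input_state n G) (100 * (n ^ 2 * max 1 (max_degree (with_proj G))))
    (\<lambda>s. min_card_answer (clique_separator (with_proj G)) (output_set n 1 (n * n) s) \<and>
      min_card_answer (stable_separator (with_proj G)) (output_set n 2 (n * n + n) s))"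
proof -
  interpret pair_graph G by (rule G(1))
  let ?D = "max 1 (max_degree (with_proj G))" and ?W = "100 * n ^ 2" and ?s = "input_state n G"
  define E where "E = (\<lambda>u w. (u, w) \<in> parcs G)"
  have "n \<le> n * n" "1 \<le> n * n" using n by simp_all
  then interpret A: adjacency_matrix n E ?W
    using n adj_not_same by unfold_locales (auto simp: E_def power2_eq_square)
  have in_verts: "u < n" "w < n" if "(u, w) \<in> parcs G" for u w
    using that G(2) wellformed by auto
  have nb: "A.nb v = neighbourhood (with_proj G) v" for v
    unfolding A.nb_def neighbourhood_def unfolding E_def using in_verts by auto
  have homog: "A.homog \<beta> v \<longleftrightarrow> homogeneous (with_proj G) \<beta> (neighbourhood (with_proj G) v)" for \<beta> v
    unfolding A.homog_def nb homogeneous_def by (auto simp: E_def)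
  have deg: "card (A.nb v) \<le> ?D" if "v < n" for v
  proof -
    have "card (A.nb v) = out_degree (with_proj G) v"
      unfolding pair_graph_out_degree[OF G(1)] nb neighbourhood_def by simp
    also have "\<dots> \<le> max_degree (with_proj G)"
      using that G(2) unfolding max_degree_def by (intro Max_ge) auto
    finally show ?thesis by simp
  qed
  have answer: "min_card_answer (\<lambda>R. minimal_vertex_separator (with_proj G) R \<and> homogeneous (with_proj G) \<beta> R) X"
    if "min_card_answer (\<lambda>R. \<exists>v < n. R = A.nb v \<and> A.homog \<beta> v) X" for \<beta> X
  proof (rule graph.min_card_answer_neighbourhood[OF graph_axioms])
    have "(\<lambda>R. \<exists>v < n. R = A.nb v \<and> A.homog \<beta> v) =
        (\<lambda>R. (\<exists>v \<in> verts (with_proj G). R = neighbourhood (with_proj G) v) \<and> homogeneous (with_proj G) \<beta> R)"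
      unfolding homog nb using G(2) by auto
    with that show "min_card_answer (\<lambda>R. (\<exists>v \<in> verts (with_proj G). R = neighbourhood (with_proj G) v) \<and>
        homogeneous (with_proj G) \<beta> R) X"
      by simp
  qed (use G n in auto)
  have clique: "clique_separator (with_proj G) =
      (\<lambda>R. minimal_vertex_separator (with_proj G) R \<and> homogeneous (with_proj G) True R)"
    and stable: "stable_separator (with_proj G) =
      (\<lambda>R. minimal_vertex_separator (with_proj G) R \<and> homogeneous (with_proj G) False R)"
    by (auto simp: clique_separator_def stable_separator_def homogeneous_def fun_eq_iff)
  have W: "1 \<le> ?W" "n * n \<le> ?W" "n * n + n \<le> ?W" "n * n + n + n \<le> ?W" "n \<le> ?W"
    using A.W A.n_le_W A.W_pos by auto
  have s: "within_words ?W ?s" "A.matrix ?s"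
  proof -
    show "within_words ?W ?s" using W by (auto simp: within_words_def input_state_def)
    show "A.matrix ?s"
      unfolding A.matrix_def unfolding E_def by (auto simp: input_state_def entry_bound)
  qed
  let ?P = "\<lambda>\<beta> X. min_card_answer (\<lambda>R. \<exists>v < n. R = A.nb v \<and> A.homog \<beta> v) X"
  let ?Q = "\<lambda>s. ?P True (output_set n 1 (n * n) s) \<and> ?P False (output_set n 2 (n * n + n) s)"
  let ?T = "45 * (n ^ 2 * ?D)"
  have "runs ?W separators ?s (1 + (1 + (?T + (1 + ?T)))) ?Q"
    unfolding separators_def
  proof (rule runs_If)
    let ?s1 = "set_reg 14 (n * n) ?s"
    show "runs ?W (Instr (Mult 14 (Reg 0) (Reg 0)) ;; search True 1 ;;
        Instr (Add 14 (Reg 14) (Reg 0)) ;; search False 2) ?s (1 + (?T + (1 + ?T))) ?Q"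
    proof (rule runs_Seq)
      show "runs ?W (Instr (Mult 14 (Reg 0) (Reg 0))) ?s 1 (\<lambda>s1. s1 = ?s1)"
        using s W by (intro runs_straight_line) (auto simp: A.matrix_def)
      fix s1 assume s1: "within_words ?W s1" "s1 = ?s1"
      have "A.matrix s1" using s(2) s1 by (simp add: A.matrix_def)
      then have 1: "runs ?W (search True 1) s1 ?T
        (\<lambda>s2. A.matrix s2 \<and> (\<forall>j. j \<in> {1, 2, 14} - {1} \<longrightarrow> reg s2 j = reg s1 j) \<and>
          (\<forall>x. x < n * n \<or> n * n + n \<le> x \<longrightarrow> mem s2 x = mem s1 x) \<and>
          ?P True (output_set n 1 (n * n) s2))"
        using s1 W deg by (intro A.runs_search) auto
      show "runs ?W (search True 1 ;; Instr (Add 14 (Reg 14) (Reg 0)) ;; search False 2) s1 (?T + (1 + ?T)) ?Q"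
      proof (rule runs_Seq[OF 1])
        fix s2 assume s2: "within_words ?W s2" "A.matrix s2 \<and> (\<forall>j. j \<in> {1, 2, 14} - {1} \<longrightarrow> reg s2 j = reg s1 j) \<and>
          (\<forall>x. x < n * n \<or> n * n + n \<le> x \<longrightarrow> mem s2 x = mem s1 x) \<and>
          ?P True (output_set n 1 (n * n) s2)"
        have reg2: "reg s2 14 = n * n" "reg s2 0 = n" using s2(2) s1(2) by (auto simp: A.matrix_def)
        let ?s3 = "set_reg 14 (n * n + n) s2"
        show "runs ?W (Instr (Add 14 (Reg 14) (Reg 0)) ;; search False 2) s2 (1 + ?T) ?Q"
        proof (rule runs_Seq)
          show "runs ?W (Instr (Add 14 (Reg 14) (Reg 0))) s2 1 (\<lambda>s3. s3 = ?s3)"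
            using s2(1) reg2 W by (intro runs_straight_line) auto
          fix s3 assume s3: "within_words ?W s3" "s3 = ?s3"
          have "A.matrix s3" using s2(2) s3 by (simp add: A.matrix_def)
          then have "runs ?W (search False 2) s3 ?T
            (\<lambda>s4. A.matrix s4 \<and> (\<forall>j. j \<in> {1, 2, 14} - {2} \<longrightarrow> reg s4 j = reg s3 j) \<and>
              (\<forall>x. x < n * n + n \<or> n * n + n + n \<le> x \<longrightarrow> mem s4 x = mem s3 x) \<and>
              ?P False (output_set n 2 (n * n + n) s4))"
            using s3 W deg by (intro A.runs_search) auto
          then show "runs ?W (search False 2) s3 ?T ?Q"
          proof (rule runs_mono)
            fix s4 :: state
            assume s4: "A.matrix s4 \<and> (\<forall>j. j \<in> {1, 2, 14} - {2} \<longrightarrow> reg s4 j = reg s3 j) \<and>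
              (\<forall>x. x < n * n + n \<or> n * n + n + n \<le> x \<longrightarrow> mem s4 x = mem s3 x) \<and>
              ?P False (output_set n 2 (n * n + n) s4)"
            have "reg s4 1 = reg s2 1" using s4 s3(2) by auto
            moreover have "mem s4 (n * n + v) = mem s2 (n * n + v)" if "v < n" for v
              using s4 s3(2) that by auto
            \<comment> \<open>The second search writes behind the first vector and into register 2 only.\<close>
            ultimately have "output_set n 1 (n * n) s4 = output_set n 1 (n * n) s2"
              by (auto simp: output_set_def)
            then show "?Q s4" using s2(2) s4 by simp
          qed simp
        qed
      qed
    qed
  qed (use n in \<open>simp add: input_state_def\<close>)
  then show ?thesis
  proof (rule runs_mono)
    have "1 \<le> n ^ 2 * ?D" using n by simp
    then show "1 + (1 + (?T + (1 + ?T))) \<le> 100 * (n ^ 2 * ?D)" by linarith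
    show "min_card_answer (clique_separator (with_proj G)) (output_set n 1 (n * n) s) \<and>
      min_card_answer (stable_separator (with_proj G)) (output_set n 2 (n * n + n) s)" if "?Q s" for s
      unfolding clique stable using that answer by blast
  qed
qed

lemma runs_separators_single_vertex:
  assumes G: "pair_graph G" "pverts G = {..<1}"
  shows "runs 100 separators (input_state 1 G) (1 + 4)
    (\<lambda>s. min_card_answer (clique_separator (with_proj G)) (output_set 1 1 1 s) \<and>
      min_card_answer (stable_separator (with_proj G)) (output_set 1 2 (1 + 1) s))"
  unfolding separators_def
proof (rule runs_If)
  have sep: "minimal_vertex_separator (with_proj G) R \<longleftrightarrow> R = {0}" for R
    using G(2) by (auto simp: minimal_vertex_separator_def)
  have "clique_separator (with_proj G) = (\<lambda>R. R = {0})" "stable_separator (with_proj G) = (\<lambda>R. R = {0})"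
    by (auto simp: clique_separator_def stable_separator_def sep fun_eq_iff)
  moreover have "min_card_answer (\<lambda>R. R = {0}) (Some {0::nat})"
    by (simp add: min_card_answer_def is_arg_min_def)
  moreover have "within_words 100 (input_state 1 G)"
    by (simp add: within_words_def input_state_def)
  ultimately show "runs 100
      (Instr (Move 1 (Imm 1)) ;; Instr (Move 2 (Imm 1)) ;;
       Instr (Store (Imm 1) (Imm 1)) ;; Instr (Store (Imm 2) (Imm 1))) (input_state 1 G) 4
      (\<lambda>s. min_card_answer (clique_separator (with_proj G)) (output_set 1 1 1 s) \<and>
        min_card_answer (stable_separator (with_proj G)) (output_set 1 2 (1 + 1) s))"
    by (intro runs_straight_line)
      (simp_all add: output_set_def input_state_def set_reg_def within_words_def)
qed (simp add: input_state_def)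

(* max 1 only matters for the one-vertex graph, the only connected graph of maximum degree 0. *)
theorem mainTheorem3:
  "\<exists>(P :: prog) (C :: nat) (k :: nat).
     \<forall>(n :: nat) (G :: nat pair_pre_digraph).
       pair_graph G \<and> pverts G = {..<n} \<and>
       connected (with_proj G) \<and> two_K2_free (with_proj G) \<longrightarrow>
       (\<exists>t s. exec (C * n ^ k) P (input_state n G) t s \<and>
          t \<le> C * (n ^ 2 * max 1 (max_degree (with_proj G))) \<and>
          min_card_answer (clique_separator (with_proj G)) (output_set n 1 (n * n) s) \<and>
          min_card_answer (stable_separator (with_proj G)) (output_set n 2 (n * n + n) s))"
proof (rule exI[of _ separators], rule exI[of _ 100], rule exI[of _ 2], intro allI impI, elim conjE)
  fix n :: nat and G :: "nat pair_pre_digraph"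
  assume G: "pair_graph G" "pverts G = {..<n}" "connected (with_proj G)" "two_K2_free (with_proj G)"
  have "n \<noteq> 0"
    using G(2,3) by (auto simp: connected_def strongly_connected_def mk_symmetric_def)
  have "runs (100 * n ^ 2) separators (input_state n G) (100 * (n ^ 2 * max 1 (max_degree (with_proj G))))
    (\<lambda>s. min_card_answer (clique_separator (with_proj G)) (output_set n 1 (n * n) s) \<and>
      min_card_answer (stable_separator (with_proj G)) (output_set n 2 (n * n + n) s))"
  proof (cases "n = 1")
    case True
    have "runs 100 separators (input_state 1 G) (1 + 4)
      (\<lambda>s. min_card_answer (clique_separator (with_proj G)) (output_set 1 1 1 s) \<and>
        min_card_answer (stable_separator (with_proj G)) (output_set 1 2 (1 + 1) s))"
      using runs_separators_single_vertex G True by simp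
    then show ?thesis
      unfolding True power_one mult_1_left mult_1_right by (rule runs_mono) auto
  next
    case False
    then show ?thesis using runs_separators G \<open>n \<noteq> 0\<close> by blast
  qed
  then show "\<exists>t s. exec (100 * n ^ 2) separators (input_state n G) t s \<and>
      t \<le> 100 * (n ^ 2 * max 1 (max_degree (with_proj G))) \<and>
      min_card_answer (clique_separator (with_proj G)) (output_set n 1 (n * n) s) \<and>
      min_card_answer (stable_separator (with_proj G)) (output_set n 2 (n * n + n) s)"
    unfolding runs_def by blast
qed

end
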